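(* For any order-invariant measure $\mu$ on $(\Omega,\mathcal F)$, there is a family $[\tilde\nu(\cdot)(\omega)]_{\omega\in\Omega}$ of extremal order-invariant probability measures on $(\Omega,\mathcal{F})$, with $\tilde\nu(\cdot)(\omega)=\hat\nu(\cdot)(\omega)$ for $\mu$-almost every $\omega$, such that $\mu$ can be decomposed as $$\mu(\cdot)=\int\tilde\nu(\cdot)(\omega)\,d\mu(\omega).$$ Moreover, this is the unique decomposition of $\mu$ as a mixture of extremal order-invariant measures, up to almost sure equality: if $w$ is a probability measure on the set $\mathcal{E}$ of extremal order-invariant measures (equipped with the evaluation $\sigma$-field) such that $\mu(E)=\int_{\mathcal{E}}\nu(E)\,w(d\nu)$ for all $E\in\mathcal F$, then $w$ is the law of $\tilde\nu$ under $\mu$, i.e. $w(S)=\mu(\{\omega:\tilde\nu(\cdot)(\omega)\in S\})$ for every set $S$ in the evaluation $\sigma$-field.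
   Context: Notation: $\mathbb{N}=\{1,2,\dots\}$, $[k]=\{1,\dots,k\}$. Partial orders are strict. A suborder of $\mathbb{N}$ (or of $[k]$) is a partial order $<^{\mathbb{N}}$ on $\mathbb{N}$ (or $<^{[k]}$ on $[k]$) such that if $i$ is below $j$ in it then $i<j$ in the standard order. For a suborder $<^{\mathbb N}$, $<^{\mathbb N}_{[k]}$ denotes its restriction to $[k]$. The space: $\Omega$ is the set of pairs $\omega=(x_1x_2\cdots,<^{\mathbb{N}})$, where $x_1x_2\cdots$ is an infinite sequence of elements of $[0,1]$ and $<^{\mathbb{N}}$ is a suborder of $\mathbb{N}$. Encoding $<^{\mathbb N}$ by the indicator function of its set of related pairs, $\Omega$ is a closed subset of $[0,1]^{\mathbb N}\times\{0,1\}^{\{(i,j):i<j\}}$ and carries the product topology. For Borel sets $B_1,\dots,B_k\subseteq[0,1]$ and a suborder $<^{[k]}$ of $[k]$, the basic event $E(B_1\cdots B_k,<^{[k]})$ is the set of $\omega=(x_1x_2\cdots,<^{\mathbb{N}})\in\Omega$ with $x_i\in B_i$ for $i=1,\dots,k$ and $<^{\mathbb{N}}_{[k]}$ equal to $<^{[k]}$. $\mathcal{F}$ is the $\sigma$-field generated by all basic events; it is the Borel $\sigma$-field of $\Omega$. Order-invariance: a linear extension of a suborder $<^{[k]}$ is a permutation $\lambda$ of $[k]$ such that $\lambda(i)<^{[k]}\lambda(j)$ implies $i<j$; $\lambda[<^{[k]}]$ is the suborder of $[k]$ in which $i$ is below $j$ if and only if $\lambda(i)<^{[k]}\lambda(j)$.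 A probability measure $\mu$ on $(\Omega,\mathcal{F})$ is order-invariant if $\mu(E(B_1\cdots B_k,<^{[k]}))=\mu(E(B_{\lambda(1)}\cdots B_{\lambda(k)},\lambda[<^{[k]}]))$ for all $k$, all Borel sets $B_1,\dots,B_k\subseteq[0,1]$, all suborders $<^{[k]}$ of $[k]$ and all linear extensions $\lambda$ of $<^{[k]}$. It is extremal if it cannot be written as $r\mu_1+(1-r)\mu_2$ with $r\in(0,1)$ and $\mu_1\neq\mu_2$ order-invariant measures. The evaluation $\sigma$-field on a set of probability measures is the one generated by the maps $\nu\mapsto\nu(E)$, $E\in\mathcal F$. The measures $\nu^k$: for $\omega=(x_1x_2\cdots,<^{\mathbb N})$, $k\in\mathbb N$ and $\lambda$ a linear extension of $<^{\mathbb N}_{[k]}$, let $\lambda^+$ be the permutation of $\mathbb N$ equal to $\lambda$ on $[k]$ and fixing all $i>k$, and let $\lambda^+[\omega]=(x_{\lambda^+(1)}x_{\lambda^+(2)}\cdots,\lambda^+[<^{\mathbb N}])$, where $i$ is below $j$ in $\lambda^+[<^{\mathbb N}]$ iff $\lambda^+(i)<^{\mathbb N}\lambda^+(j)$. For $E\in\mathcal F$, $\nu^k(E)(\omega)$ is the proportion of linear extensions $\lambda$ of $<^{\mathbb N}_{[k]}$ such that $\lambda^+[\omega]\in E$; $\nu^k(\cdot)(\omega)$ is a probability measure. Tail $\sigma$-field: for $i\in\mathbb N$ let $\lambda^{(i)}$ be the permutation of $\mathbb N$ exchanging $i$ and $i+1$; for $\omega=(x_1x_2\cdots,<^{\mathbb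 N})$ let $\lambda^{(i)}[\omega]=(x_{\lambda^{(i)}(1)}x_{\lambda^{(i)}(2)}\cdots,\lambda^{(i)}[<^{\mathbb N}])$ if $i,i+1$ are incomparable in $<^{\mathbb N}$, and $\lambda^{(i)}[\omega]=\omega$ if $i<^{\mathbb N}i+1$. Let $\mathcal G_k=\{H\in\mathcal F:\omega\in H\Rightarrow\lambda^{(i)}[\omega]\in H\text{ for all }i<k\}$ and $\mathcal G=\bigcap_k\mathcal G_k$. The family $\hat\nu$: $[\hat\nu(\cdot)(\omega)]_{\omega\in\Omega}$ denotes a fixed family of order-invariant probability measures on $(\Omega,\mathcal F)$ (such a family exists), with $\omega\mapsto\hat\nu(E)(\omega)$ $\mathcal G$-measurable for each $E\in\mathcal F$, such that for every order-invariant measure $\mu$: for $\mu$-almost every $\omega$, $\nu^k(\cdot)(\omega)$ converges weakly to $\hat\nu(\cdot)(\omega)$ as $k\to\infty$; and for each $E\in\mathcal F$, $\hat\nu(E)=\mu(E\mid\mathcal G)=\lim_{k}\nu^k(E)$ $\mu$-almost surely. Since $\tilde\nu=\hat\nu$ $\mu$-a.s., $\tilde\nu$ is measurable with respect to the $\mu$-completion, and its law under $\mu$ is understood in that sense. *)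

theory Defs
  imports "HOL-Probability.Probability" "HOL-Combinatorics.Permutations"
begin

text \<open>
  The index set of the positive integers is represented by the type \<^typ>\<open>nat\<close>, its \<open>i\<close>-th element
  being represented by \<open>i - 1\<close>; accordingly the initial segment with \<open>k\<close> elements is \<open>{..<k}\<close>.
  A relation on \<open>{..<k}\<close> is a relation on \<^typ>\<open>nat\<close> that only relates elements of \<open>{..<k}\<close>.
\<close>

definition suborder :: "(nat \<Rightarrow> nat \<Rightarrow> bool) \<Rightarrow> bool" where
  "suborder R \<longleftrightarrow> irreflp R \<and> transp R \<and> (\<forall>i j. R i j \<longrightarrow> i < j)"

definition suborder_upto :: "nat \<Rightarrow> (nat \<Rightarrow> nat \<Rightarrow> bool) \<Rightarrow> bool" where
  "suborder_upto k R \<longleftrightarrow> suborder R \<and> (\<forall>i j. R i j \<longrightarrow> i < k \<and> j < k)"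

definition restrict_order :: "nat \<Rightarrow> (nat \<Rightarrow> nat \<Rightarrow> bool) \<Rightarrow> (nat \<Rightarrow> nat \<Rightarrow> bool)" where
  "restrict_order k R = (\<lambda>i j. i < k \<and> j < k \<and> R i j)"

definition linear_extensions :: "nat \<Rightarrow> (nat \<Rightarrow> nat \<Rightarrow> bool) \<Rightarrow> (nat \<Rightarrow> nat) set" where
  "linear_extensions k R =
    {l. l permutes {..<k} \<and> (\<forall>i<k. \<forall>j<k. R (l i) (l j) \<longrightarrow> i < j)}"

definition permute_order :: "(nat \<Rightarrow> nat) \<Rightarrow> (nat \<Rightarrow> nat \<Rightarrow> bool) \<Rightarrow> (nat \<Rightarrow> nat \<Rightarrow> bool)" where
  "permute_order l R = (\<lambda>i j. R (l i) (l j))"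

type_synonym point = "(nat \<Rightarrow> real) \<times> (nat \<Rightarrow> nat \<Rightarrow> bool)"

definition Omega :: "point set" where
  "Omega = {(x, R). (\<forall>i. x i \<in> {0..1}) \<and> suborder R}"

definition basic_event ::
    "nat \<Rightarrow> (nat \<Rightarrow> real set) \<Rightarrow> (nat \<Rightarrow> nat \<Rightarrow> bool) \<Rightarrow> point set" where
  "basic_event k B R =
    {(x, S). (x, S) \<in> Omega \<and> (\<forall>i<k. x i \<in> B i) \<and> restrict_order k S = R}"

definition borel_in_unit :: "real set \<Rightarrow> bool" where
  "borel_in_unit A \<longleftrightarrow> A \<in> sets borel \<and> A \<subseteq> {0..1}"

definition basic_events :: "point set set" where
  "basic_events =
    {basic_event k B R | k B R. (\<forall>i<k. borel_in_unit (B i)) \<and> suborder_upto k R}"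

text \<open>Only the space and the \<open>\<sigma>\<close>-field of this measure matter.\<close>

definition F_alg :: "point measure" where
  "F_alg = sigma Omega basic_events"

definition order_invariant :: "point measure \<Rightarrow> bool" where
  "order_invariant \<mu> \<longleftrightarrow>
    prob_space \<mu> \<and> sets \<mu> = sets F_alg \<and>
    (\<forall>k B R l. (\<forall>i<k. borel_in_unit (B i)) \<longrightarrow> suborder_upto k R \<longrightarrow> l \<in> linear_extensions k R \<longrightarrow>
      measure \<mu> (basic_event k B R) = measure \<mu> (basic_event k (\<lambda>i. B (l i)) (permute_order l R)))"

definition extremal :: "point measure \<Rightarrow> bool" where
  "extremal \<mu> \<longleftrightarrow>
    \<not> (\<exists>r \<mu>1 \<mu>2. 0 < r \<and> r < 1 \<and> order_invariant \<mu>1 \<and> order_invariant \<mu>2 \<and> \<mu>1 \<noteq> \<mu>2 \<and>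
        (\<forall>E\<in>sets F_alg. measure \<mu> E = r * measure \<mu>1 E + (1 - r) * measure \<mu>2 E))"

definition extremal_measures :: "point measure set" where
  "extremal_measures = {\<mu>. order_invariant \<mu> \<and> extremal \<mu>}"

text \<open>
  The \<open>\<sigma>\<close>-field of \<^const>\<open>prob_algebra\<close> is generated by the evaluation maps, hence so is its trace.
\<close>

definition extremal_algebra :: "point measure measure" where
  "extremal_algebra = restrict_space (prob_algebra F_alg) extremal_measures"

definition permute_point :: "(nat \<Rightarrow> nat) \<Rightarrow> point \<Rightarrow> point" where
  "permute_point l \<omega> = (\<lambda>i. fst \<omega> (l i), permute_order l (snd \<omega>))"

text \<open>
  A permutation \<open>l\<close> with \<open>l permutes {..<k}\<close> is the identity outside \<open>{..<k}\<close>, so that it already is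
  the extension of a permutation of \<open>{..<k}\<close> to all indices.  The lemma \<open>measure_nu\<close> below
  gives \<open>nu\<close> as a proportion of linear extensions.
\<close>

definition nu :: "nat \<Rightarrow> point \<Rightarrow> point measure" where
  "nu k \<omega> =
    distr (uniform_count_measure (linear_extensions k (restrict_order k (snd \<omega>)))) F_alg
      (\<lambda>l. permute_point l \<omega>)"

definition swap_point :: "nat \<Rightarrow> point \<Rightarrow> point" where
  "swap_point i \<omega> =
    (if snd \<omega> i (Suc i) then \<omega> else permute_point (Transposition.transpose i (Suc i)) \<omega>)"

text \<open>The exchanged indices \<open>i\<close> and \<open>Suc i\<close> both lie in \<open>{..<k}\<close>.\<close>

definition G_upto :: "nat \<Rightarrow> point set set" where
  "G_upto k = {H \<in> sets F_alg. \<forall>\<omega>\<in>H. \<forall>i. Suc i < k \<longrightarrow> swap_point i \<omega> \<in> H}"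

definition G_alg :: "point measure" where
  "G_alg = sigma Omega (\<Inter>k. G_upto k)"

text \<open>
  The topology on \<^typ>\<open>point\<close> is the product topology, with \<^typ>\<open>bool\<close> discrete.
\<close>

definition weak_conv_Omega :: "(nat \<Rightarrow> point measure) \<Rightarrow> point measure \<Rightarrow> bool" where
  "weak_conv_Omega M N \<longleftrightarrow>
    (\<forall>f :: point \<Rightarrow> real. continuous_on Omega f \<longrightarrow> bounded (f ` Omega) \<longrightarrow>
      (\<lambda>k. integral\<^sup>L (M k) f) \<longlonglongrightarrow> integral\<^sup>L N f)"

definition limit_family :: "(point \<Rightarrow> point measure) \<Rightarrow> bool" where
  "limit_family N \<longleftrightarrow>
    (\<forall>\<omega>\<in>Omega. order_invariant (N \<omega>)) \<and>
    (\<forall>E\<in>sets F_alg. (\<lambda>\<omega>. measure (N \<omega>) E) \<in> borel_measurable G_alg) \<and>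
    (\<forall>\<mu>. order_invariant \<mu> \<longrightarrow>
      (AE \<omega> in \<mu>. weak_conv_Omega (\<lambda>k. nu k \<omega>) (N \<omega>)) \<and>
      (\<forall>E\<in>sets F_alg.
        (AE \<omega> in \<mu>. measure (N \<omega>) E = real_cond_exp \<mu> G_alg (indicator E) \<omega>) \<and>
        (AE \<omega> in \<mu>. (\<lambda>k. measure (nu k \<omega>) E) \<longlonglongrightarrow> measure (N \<omega>) E)))"

lemma basic_events_subset: "basic_events \<subseteq> Pow Omega"
  by (auto simp: basic_events_def basic_event_def)

lemma space_F_alg [simp]: "space F_alg = Omega"
  and sets_F_alg: "sets F_alg = sigma_sets Omega basic_events"
  using basic_events_subset by (simp_all add: F_alg_def space_measure_of sets_measure_of)

lemma permute_point_in_Omega: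
  assumes "\<omega> \<in> Omega" "l \<in> linear_extensions k (restrict_order k (snd \<omega>))"
  shows "permute_point l \<omega> \<in> Omega"
proof -
  obtain x R where \<omega>: "\<omega> = (x, R)" by fastforce
  have x: "\<And>i. x i \<in> {0..1}" and ir: "irreflp R" and tr: "transp R" and lt: "\<And>i j. R i j \<Longrightarrow> i < j"
    using assms(1) by (auto simp: Omega_def suborder_def \<omega>)
  have perm: "l permutes {..<k}"
    and ext: "\<And>i j. i < k \<Longrightarrow> j < k \<Longrightarrow> R (l i) (l j) \<Longrightarrow> i < j"
    using assms(2) permutes_in_image[of l "{..<k}"]
    by (auto simp: linear_extensions_def restrict_order_def \<omega>)
  have "i < j" if "R (l i) (l j)" for i j
  proof -
    have in_k: "l m < k \<longleftrightarrow> m < k" for m using permutes_in_image[OF perm, of m] by simp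
    have out: "l m = m" if "\<not> m < k" for m using permutes_not_in[OF perm, of m] that by simp
    from lt[OF that] have "l i < l j" .
    then show ?thesis using ext[OF _ _ that] in_k out by (metis le_less_trans not_le order.strict_trans)
  qed
  moreover have "irreflp (permute_order l R)" "transp (permute_order l R)"
    using ir tr by (auto simp: permute_order_def irreflp_def transp_def)
  ultimately show ?thesis
    using x by (auto simp: permute_point_def Omega_def suborder_def \<omega> permute_order_def)
qed

lemma finite_linear_extensions: "finite (linear_extensions k R)"
  by (rule finite_subset[OF _ finite_permutations[of "{..<k}"]]) (auto simp: linear_extensions_def)

lemma measure_nu:
  assumes "\<omega> \<in> Omega" "E \<in> sets F_alg"
  shows "measure (nu k \<omega>) E =
    real (card {l \<in> linear_extensions k (restrict_order k (snd \<omega>)). permute_point l \<omega> \<in> E}) /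
    real (card (linear_extensions k (restrict_order k (snd \<omega>))))"
proof -
  let ?L = "linear_extensions k (restrict_order k (snd \<omega>))"
  have "(\<lambda>l. permute_point l \<omega>) \<in> uniform_count_measure ?L \<rightarrow>\<^sub>M F_alg"
    using permute_point_in_Omega[OF assms(1)]
    by (auto simp: measurable_def space_uniform_count_measure sets_uniform_count_measure)
  then have "measure (nu k \<omega>) E =
      measure (uniform_count_measure ?L) ((\<lambda>l. permute_point l \<omega>) -` E \<inter> ?L)"
    unfolding nu_def by (subst measure_distr) (use assms in \<open>auto simp: space_uniform_count_measure\<close>)
  also have "(\<lambda>l. permute_point l \<omega>) -` E \<inter> ?L = {l \<in> ?L. permute_point l \<omega> \<in> E}" by auto
  finally show ?thesis
    by (simp add: measure_uniform_count_measure finite_linear_extensions)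
qed

lemma swap_point_in_Omega:
  assumes "\<omega> \<in> Omega"
  shows "swap_point i \<omega> \<in> Omega"
proof (cases "snd \<omega> i (Suc i)")
  case True
  then show ?thesis using assms by (simp add: swap_point_def)
next
  case False
  have lt: "snd \<omega> a b \<Longrightarrow> a < b" for a b
    using assms by (auto simp: Omega_def suborder_def)
  have "Transposition.transpose i (Suc i) \<in> linear_extensions (i + 2) (restrict_order (i + 2) (snd \<omega>))"
  proof -
    have "Transposition.transpose i (Suc i) permutes {..<i + 2}" by (rule permutes_swap_id) auto
    moreover have "a < b"
      if "snd \<omega> (Transposition.transpose i (Suc i) a) (Transposition.transpose i (Suc i) b)" for a b
      using lt[OF that] that False by (auto simp: Transposition.transpose_def split: if_splits)
    ultimately show ?thesis by (auto simp: linear_extensions_def restrict_order_def)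
  qed
  then show ?thesis using permute_point_in_Omega[OF assms] False by (simp add: swap_point_def)
qed

lemma swap_point_involutory:
  assumes "\<omega> \<in> Omega"
  shows "swap_point i (swap_point i \<omega>) = \<omega>"
proof -
  have "\<not> snd \<omega> (Suc i) i"
    using assms by (auto simp: Omega_def suborder_def dest: spec2 less_asym)
  then show ?thesis
    by (cases \<omega>) (auto simp: swap_point_def permute_point_def permute_order_def)
qed

lemma sigma_algebra_G: "sigma_algebra Omega (\<Inter>k. G_upto k)"
proof -
  have eq: "(\<Inter>k. G_upto k) = {H \<in> sets F_alg. \<forall>\<omega>\<in>H. \<forall>i. swap_point i \<omega> \<in> H}"
    by (auto simp: G_upto_def)
  show ?thesis
    unfolding eq sigma_algebra_iff2
  proof (intro conjI ballI allI impI)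
    show "{H \<in> sets F_alg. \<forall>\<omega>\<in>H. \<forall>i. swap_point i \<omega> \<in> H} \<subseteq> Pow Omega"
      using sets.sets_into_space[of _ F_alg] by auto
  next
    fix H assume H: "H \<in> {H \<in> sets F_alg. \<forall>\<omega>\<in>H. \<forall>i. swap_point i \<omega> \<in> H}"
    then have "Omega - H \<in> sets F_alg"
      using sets.compl_sets[of H F_alg] by auto
    moreover have "swap_point i \<omega> \<in> Omega - H" if "\<omega> \<in> Omega - H" for \<omega> i
    proof
      show "swap_point i \<omega> \<in> Omega" using that swap_point_in_Omega by blast
      show "swap_point i \<omega> \<notin> H"
      proof
        assume "swap_point i \<omega> \<in> H"
        then have "swap_point i (swap_point i \<omega>) \<in> H" using H by blast
        then show False using that swap_point_involutory[of \<omega> i] by simp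
      qed
    qed
    ultimately show "Omega - H \<in> {H \<in> sets F_alg. \<forall>\<omega>\<in>H. \<forall>i. swap_point i \<omega> \<in> H}"
      by blast
  next
    fix A :: "nat \<Rightarrow> point set"
    assume "range A \<subseteq> {H \<in> sets F_alg. \<forall>\<omega>\<in>H. \<forall>i. swap_point i \<omega> \<in> H}"
    then show "(\<Union>i. A i) \<in> {H \<in> sets F_alg. \<forall>\<omega>\<in>H. \<forall>i. swap_point i \<omega> \<in> H}"
      by blast
  qed auto
qed

lemma space_G_alg [simp]: "space G_alg = Omega"
  and sets_G_alg: "sets G_alg = (\<Inter>k. G_upto k)"
proof -
  interpret sigma_algebra Omega "\<Inter>k. G_upto k" by (rule sigma_algebra_G)
  show "space G_alg = Omega" "sets G_alg = (\<Inter>k. G_upto k)"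
    using space_closed by (simp_all add: G_alg_def space_measure_of sets_measure_of sigma_sets_eq)
qed

lemma suborder_upto_restrict: "suborder S \<Longrightarrow> suborder_upto k (restrict_order k S)"
  by (auto simp: suborder_upto_def suborder_def restrict_order_def irreflp_def transp_def)

lemma finite_suborder_upto: "finite {R. suborder_upto k R}"
proof -
  have "{R. suborder_upto k R} \<subseteq> (\<lambda>A i j. (i, j) \<in> A) ` Pow ({..<k} \<times> {..<k})"
  proof
    fix R assume "R \<in> {R. suborder_upto k R}"
    then have "{(i, j). R i j} \<in> Pow ({..<k} \<times> {..<k})" by (auto simp: suborder_upto_def)
    moreover have "R = (\<lambda>i j. (i, j) \<in> {(i, j). R i j})" by simp
    ultimately show "R \<in> (\<lambda>A i j. (i, j) \<in> A) ` Pow ({..<k} \<times> {..<k})" by blast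
  qed
  then show ?thesis by (rule finite_subset) simp
qed

lemma basic_event_in_sets:
  assumes "\<And>i. i < k \<Longrightarrow> borel_in_unit (B i)" "suborder_upto k R"
  shows "basic_event k B R \<in> sets F_alg"
  unfolding sets_F_alg basic_events_def using assms by blast

instance bool :: second_countable_topology
proof
  have "open = generate_topology (range (\<lambda>a. {..< a}) \<union> range (\<lambda>a :: bool. {a <..}))"
    by (rule open_bool_def)
  moreover have "countable (range (\<lambda>a. {..< a}) \<union> range (\<lambda>a :: bool. {a <..}))"
    by (simp add: countable_finite)
  ultimately show "\<exists>B :: bool set set. countable B \<and> open = generate_topology B"
    by blast
qed

lemma sets_F_alg_borel: "sets F_alg = sets (restrict_space borel Omega)"
proof
  have m1: "(\<lambda>\<omega>. fst \<omega> i) \<in> borel_measurable (borel :: point measure)" for i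
    by (rule borel_measurable_continuous_onI,
        rule continuous_on_product_then_coordinatewise[OF continuous_on_fst[OF continuous_on_id]])
  have m2: "(\<lambda>\<omega>. snd \<omega> i j) \<in> borel_measurable (borel :: point measure)" for i j
    by (rule borel_measurable_continuous_onI,
        rule continuous_on_product_then_coordinatewise[OF
          continuous_on_product_then_coordinatewise[OF continuous_on_snd[OF continuous_on_id]]])
  have m3: "{\<omega>. snd \<omega> i j} \<in> sets (borel :: point measure)" for i j
    using measurable_sets[OF m2[of i j], of "{True}"] by (simp add: vimage_def)
  have "basic_events \<subseteq> sets (restrict_space borel Omega)"
  proof
    fix E assume "E \<in> basic_events"
    then obtain k B R where E: "E = basic_event k B R" and B: "\<And>i. i < k \<Longrightarrow> B i \<in> sets borel"
      by (auto simp: basic_events_def borel_in_unit_def)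
    have "(if i < k then (\<lambda>\<omega>. fst \<omega> i) -` B i else UNIV) \<in> sets (borel :: point measure)" for i
      using measurable_sets[OF m1[of i] B[of i]] by simp
    then have "(\<Inter>i. (if i < k then (\<lambda>\<omega>. fst \<omega> i) -` B i else UNIV)) \<in> sets (borel :: point measure)"
      by (intro sets.countable_INT'') simp_all
    also have "(\<Inter>i. (if i < k then (\<lambda>\<omega> :: point. fst \<omega> i) -` B i else UNIV)) =
        {\<omega>. \<forall>i<k. fst \<omega> i \<in> B i}"
      by (auto split: if_splits)
    finally have 1: "{\<omega>. \<forall>i<k. fst \<omega> i \<in> B i} \<in> sets (borel :: point measure)" .
    have eq: "{\<omega>. (i < k \<and> j < k \<and> snd \<omega> i j) = R i j} \<in> sets (borel :: point measure)" for i j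
    proof (cases "i < k \<and> j < k")
      case True
      then have "{\<omega> :: point. (i < k \<and> j < k \<and> snd \<omega> i j) = R i j} =
          (if R i j then {\<omega>. snd \<omega> i j} else - {\<omega>. snd \<omega> i j})"
        by auto
      then show ?thesis using m3[of i j] borel_comp[OF m3[of i j]] by (simp split: if_splits)
    next
      case False
      then have "{\<omega> :: point. (i < k \<and> j < k \<and> snd \<omega> i j) = R i j} = (if R i j then {} else UNIV)"
        by auto
      then show ?thesis by simp
    qed
    have "(\<Inter>i. \<Inter>j. {\<omega>. (i < k \<and> j < k \<and> snd \<omega> i j) = R i j}) \<in> sets (borel :: point measure)"
      by (intro sets.countable_INT'' eq countableI_type borel_open[OF open_UNIV])
    also have "(\<Inter>i. \<Inter>j. {\<omega> :: point. (i < k \<and> j < k \<and> snd \<omega> i j) = R i j}) =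
        {\<omega>. restrict_order k (snd \<omega>) = R}"
      by (auto simp: restrict_order_def fun_eq_iff)
    finally have 2: "{\<omega> :: point. restrict_order k (snd \<omega>) = R} \<in> sets borel" .
    have "E = Omega \<inter> ({\<omega>. \<forall>i<k. fst \<omega> i \<in> B i} \<inter> {\<omega>. restrict_order k (snd \<omega>) = R})"
      by (auto simp: E basic_event_def)
    then show "E \<in> sets (restrict_space borel Omega)"
      unfolding sets_restrict_space using 1 2 by blast
  qed
  then show "sets F_alg \<subseteq> sets (restrict_space borel Omega)"
    unfolding F_alg_def
    by (metis sets.sigma_sets_subset sets_F_alg F_alg_def space_restrict_space space_borel Int_UNIV_right)
next
  have c1: "(\<lambda>\<omega>. fst \<omega> i) \<in> borel_measurable F_alg" for i
  proof (rule measurableI)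
    fix A :: "real set" assume A: "A \<in> sets borel"
    let ?B = "\<lambda>j. if j = i then A \<inter> {0..1} else {0..1}"
    have "(\<lambda>\<omega>. fst \<omega> i) -` A \<inter> space F_alg =
        (\<Union>R\<in>{R. suborder_upto (Suc i) R}. basic_event (Suc i) ?B R)" (is "?X = ?Y")
    proof
      show "?X \<subseteq> ?Y"
        using suborder_upto_restrict by (auto simp: basic_event_def Omega_def)
      show "?Y \<subseteq> ?X" by (auto simp: basic_event_def)
    qed
    moreover have "?Y \<in> sets F_alg"
      using A by (intro sets.finite_UN finite_suborder_upto basic_event_in_sets)
        (auto simp: borel_in_unit_def)
    ultimately show "(\<lambda>\<omega>. fst \<omega> i) -` A \<inter> space F_alg \<in> sets F_alg" by simp
  qed simp
  have c2: "Measurable.pred F_alg (\<lambda>\<omega>. snd \<omega> i j)" for i j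
  proof -
    let ?k = "Suc (max i j)"
    have "{\<omega> \<in> space F_alg. snd \<omega> i j} =
        (\<Union>R\<in>{R. suborder_upto ?k R \<and> R i j}. basic_event ?k (\<lambda>_. {0..1}) R)" (is "?X = ?Y")
    proof
      have "restrict_order ?k S i j = S i j" for S by (auto simp: restrict_order_def)
      then show "?X \<subseteq> ?Y"
        using suborder_upto_restrict[of _ ?k] by (auto simp: basic_event_def Omega_def)
      show "?Y \<subseteq> ?X" by (auto simp: basic_event_def restrict_order_def)
    qed
    moreover have "?Y \<in> sets F_alg"
      by (intro sets.finite_UN finite_subset[OF _ finite_suborder_upto[of ?k]] basic_event_in_sets)
        (auto simp: borel_in_unit_def)
    ultimately show ?thesis by (simp add: pred_def)
  qed
  have c2': "(\<lambda>\<omega>. snd \<omega> i j) \<in> borel_measurable F_alg" for i j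
    using c2[of i j] by (rule measurable_compose) simp
  have "fst \<in> borel_measurable F_alg"
    by (rule measurable_coordinatewise_then_product[of fst]) (rule c1)
  moreover have "snd \<in> borel_measurable F_alg"
    by (rule measurable_coordinatewise_then_product[of snd],
        rule measurable_coordinatewise_then_product, rule c2')
  ultimately have "(\<lambda>\<omega>. (fst \<omega>, snd \<omega>)) \<in> borel_measurable F_alg"
    by (rule borel_measurable_Pair)
  then have "(\<lambda>\<omega>. \<omega>) \<in> F_alg \<rightarrow>\<^sub>M restrict_space borel Omega"
    by (intro measurable_restrict_space2) auto
  then show "sets (restrict_space borel Omega) \<subseteq> sets F_alg"
    using measurable_sets[of "\<lambda>\<omega>. \<omega>" F_alg "restrict_space borel Omega"]
      sets.sets_into_space[of _ "restrict_space borel Omega"]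
    by (fastforce simp: space_restrict_space Int_absorb2)
qed

lemma space_extremal_algebra: "space extremal_algebra = extremal_measures"
  by (auto simp: extremal_algebra_def space_restrict_space space_prob_algebra
      extremal_measures_def order_invariant_def)

end

theory Submission
  imports Defs
begin

text \<open>
  Let \<open>N\<close> be the limit family.  It is one kernel that serves as the conditional probability given
  the tail \<open>\<sigma>\<close>-field under \<^emph>\<open>every\<close> order-invariant measure, and its values are themselves
  order-invariant.  The decomposition follows from these two properties and from
  the countable generation of \<^const>\<open>F_alg\<close>, as in the theory of sufficient statistics.

  An order-invariant \<open>\<nu>\<close> is extremal exactly when \<open>N = \<nu>\<close> holds \<open>\<nu>\<close>-almost surely.  If \<open>N = \<nu>\<close>
  almost surely and \<open>\<nu>\<close> is a mixture of \<open>\<mu>1\<close> and \<open>\<mu>2\<close>, then \<open>N = \<nu>\<close> also holds almost surely under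
  both components, and averaging \<open>N\<close> over a component shows that it equals \<open>\<nu>\<close>
  (\<open>extremal_if_concentrated\<close>).  Conversely, conditioning \<open>\<nu>\<close> on a tail event gives an average of
  values of \<open>N\<close>, hence an order-invariant measure; so a tail event of probability strictly between
  0 and 1 would split \<open>\<nu>\<close>.  For extremal \<open>\<nu>\<close> the tail is therefore trivial, and the
  tail-measurable \<open>N\<close> is almost surely constant (\<open>concentrated_if_extremal\<close>).

  For existence it has to be seen that \<open>N \<omega>\<close> is extremal for \<open>\<mu>\<close>-almost every \<open>\<omega>\<close>.  A tail event \<open>H\<close>
  satisfies \<open>N \<omega> H = indicator H \<omega>\<close> almost surely.  Applied to the countably many tail events
  \<open>{N(E) \<le> q}\<close>, with \<open>E\<close> from a countable separating family and \<open>q\<close> rational, this says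
  that \<open>N \<omega>\<close> is concentrated on the points \<open>\<omega>'\<close> with \<open>N \<omega>' = N \<omega>\<close>, which is the criterion above
  (\<open>AE_concentrated_points\<close>).  On the null set where this fails, \<open>N \<omega>\<close> is replaced by a fixed
  extremal measure (\<open>extremal_version\<close>); call the result \<open>V\<close>.

  For uniqueness, let \<open>w\<close> represent \<open>\<mu>\<close> and let \<open>T\<close> be the event \<open>V \<in> S\<close>.  Since \<open>V = \<nu>\<close> holds
  \<open>\<nu>\<close>-almost surely for each extremal \<open>\<nu>\<close>, the number \<open>\<nu>(T)\<close> is 1 or 0 according as \<open>\<nu> \<in> S\<close> or
  not, and integrating against \<open>w\<close> gives \<open>\<mu>(T) = w(S)\<close>.
\<close>

section \<open>A countable family of events that separates probability measures\<close>

lemma sets_Collect_Ball_countable: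
  assumes "countable I" "\<And>i. i \<in> I \<Longrightarrow> {x \<in> space M. P i x} \<in> sets M"
  shows "{x \<in> space M. \<forall>i\<in>I. P i x} \<in> sets M"
proof -
  have "{x \<in> space M. \<forall>i\<in>I. P i x} = space M - (\<Union>i\<in>I. space M - {x \<in> space M. P i x})"
    by auto
  also have "\<dots> \<in> sets M"
    using assms by (intro sets.Diff sets.top sets.countable_UN'') auto
  finally show ?thesis .
qed

lemma countable_Int_stable_generator_borel:
  obtains C :: "'a :: second_countable_topology set set"
  where "countable C" "Int_stable C" "UNIV \<in> C" "sets borel = sigma_sets UNIV C"
proof -
  obtain B :: "'a set set" where B: "countable B" "topological_basis B"
    using ex_countable_basis by blast
  define C where "C = Inter ` {F. F \<subseteq> B \<and> finite F}"
  have "countable C"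
    unfolding C_def using B(1) by (intro countable_image) (simp add: countable_Collect_finite_subset conj_commute)
  moreover have "Int_stable C"
  proof (rule Int_stableI)
    fix a b assume "a \<in> C" "b \<in> C"
    then obtain F G where "a = \<Inter>F" "b = \<Inter>G" "F \<subseteq> B" "G \<subseteq> B" "finite F" "finite G"
      by (auto simp: C_def)
    then have "a \<inter> b = \<Inter>(F \<union> G)" "F \<union> G \<subseteq> B" "finite (F \<union> G)" by auto
    then show "a \<inter> b \<in> C" unfolding C_def by blast
  qed
  moreover have "UNIV \<in> C" unfolding C_def by force
  moreover have "sets borel = sigma_sets UNIV C"
  proof
    have "B \<subseteq> C"
    proof
      fix b assume "b \<in> B"
      then show "b \<in> C" unfolding C_def by (intro image_eqI[of _ _ "{b}"]) auto
    qed
    then show "sets borel \<subseteq> sigma_sets UNIV C"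
      using sigma_sets_mono'[of B C UNIV] by (simp add: borel_eq_countable_basis[OF B])
    have "open c" if "c \<in> C" for c
      using that topological_basis_open[OF B(2)] by (auto simp: C_def intro!: open_Inter)
    then show "sigma_sets UNIV C \<subseteq> sets borel"
      using sets.sigma_sets_subset[of C borel] by (metis borel_open space_borel subsetI)
  qed
  ultimately show ?thesis by (rule that)
qed

text \<open>
  Countability is what turns "almost surely \<open>N(E) = \<nu>(E)\<close>, for each event \<open>E\<close>" into "almost surely
  \<open>N = \<nu>\<close>", and what makes \<open>N = \<nu>\<close> a measurable condition.
\<close>

lemma countable_separating_events:
  obtains C where "countable C" "C \<subseteq> sets F_alg"
    "\<And>\<mu> \<nu>. order_invariant \<mu> \<Longrightarrow> order_invariant \<nu> \<Longrightarrow>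
      (\<And>E. E \<in> C \<Longrightarrow> measure \<mu> E = measure \<nu> E) \<Longrightarrow> \<mu> = \<nu>"
proof -
  obtain D :: "point set set"
    where D: "countable D" "Int_stable D" "UNIV \<in> D" "sets borel = sigma_sets UNIV D"
    using countable_Int_stable_generator_borel by blast
  define C where "C = (\<lambda>A. A \<inter> Omega) ` D"
  have gen: "sets F_alg = sigma_sets Omega C"
  proof -
    have "sets F_alg = {id -` A \<inter> Omega | A. A \<in> sigma_sets UNIV D}"
      unfolding sets_F_alg_borel sets_restrict_space D(4) by auto
    also have "\<dots> = sigma_sets Omega {id -` A \<inter> Omega | A. A \<in> D}"
      by (rule sigma_sets_vimage_commute) simp
    also have "{id -` A \<inter> Omega | A. A \<in> D} = C" by (auto simp: C_def)
    finally show ?thesis .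
  qed
  have "Int_stable C"
  proof (rule Int_stableI)
    fix a b assume "a \<in> C" "b \<in> C"
    then obtain A B where "A \<in> D" "B \<in> D" "a \<inter> b = (A \<inter> B) \<inter> Omega" by (auto simp: C_def)
    then show "a \<inter> b \<in> C" using D(2) by (auto simp: C_def Int_stable_def)
  qed
  have "Omega \<in> C" using D(3) by (force simp: C_def)
  have "\<mu> = \<nu>"
    if "order_invariant \<mu>" "order_invariant \<nu>" and eq: "\<And>E. E \<in> C \<Longrightarrow> measure \<mu> E = measure \<nu> E"
    for \<mu> \<nu>
  proof (rule measure_eqI_generator_eq)
    interpret \<mu>: prob_space \<mu> using that by (simp add: order_invariant_def)
    interpret \<nu>: prob_space \<nu> using that by (simp add: order_invariant_def)
    show "Int_stable C" by fact
    show "C \<subseteq> Pow Omega" by (auto simp: C_def)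
    show "emeasure \<mu> E = emeasure \<nu> E" if "E \<in> C" for E
      using eq[OF that] by (simp add: \<mu>.emeasure_eq_measure \<nu>.emeasure_eq_measure)
    show "sets \<mu> = sigma_sets Omega C" "sets \<nu> = sigma_sets Omega C"
      using that gen by (simp_all add: order_invariant_def)
    show "range (\<lambda>_::nat. Omega) \<subseteq> C" using \<open>Omega \<in> C\<close> by auto
    show "(\<Union>i::nat. Omega) = Omega" by simp
    show "emeasure \<mu> Omega \<noteq> \<infinity>" by simp
  qed
  moreover have "countable C" "C \<subseteq> sets F_alg"
    using D(1) gen by (auto simp: C_def)
  ultimately show ?thesis using that by blast
qed

section \<open>The limit family as a conditional probability\<close>

lemma sets_G_alg_subset: "sets G_alg \<subseteq> sets F_alg"
  by (auto simp: sets_G_alg G_upto_def)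

lemma order_invariant_space: "order_invariant \<mu> \<Longrightarrow> space \<mu> = Omega"
  using sets_eq_imp_space_eq[of \<mu> F_alg] by (simp add: order_invariant_def)

lemma order_invariant_subalgebra: "order_invariant \<mu> \<Longrightarrow> finite_measure_subalgebra \<mu> G_alg"
  unfolding finite_measure_subalgebra_def finite_measure_subalgebra_axioms_def subalgebra_def
  using sets_G_alg_subset
  by (simp add: order_invariant_space) (auto simp: order_invariant_def prob_space_def)

lemma limit_family_measurable:
  assumes "limit_family N" "E \<in> sets F_alg" "sets M = sets F_alg"
  shows "(\<lambda>\<omega>. measure (N \<omega>) E) \<in> borel_measurable M"
proof -
  have "space M = Omega" using sets_eq_imp_space_eq[OF assms(3)] by simp
  then have "subalgebra M G_alg"
    using sets_G_alg_subset assms(3) by (simp add: subalgebra_def)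
  moreover have "(\<lambda>\<omega>. measure (N \<omega>) E) \<in> borel_measurable G_alg"
    using assms by (simp add: limit_family_def)
  ultimately show ?thesis by (rule measurable_from_subalg)
qed

lemma limit_family_integrable:
  assumes "limit_family N" "order_invariant \<mu>" "E \<in> sets F_alg"
  shows "integrable \<mu> (\<lambda>\<omega>. measure (N \<omega>) E)"
proof -
  interpret prob_space \<mu> using assms(2) by (simp add: order_invariant_def)
  have "measure (N \<omega>) E \<le> 1" if "\<omega> \<in> Omega" for \<omega>
    using that assms(1) by (auto simp: limit_family_def order_invariant_def intro!: prob_space.prob_le_1)
  moreover have "(\<lambda>\<omega>. measure (N \<omega>) E) \<in> borel_measurable \<mu>"
    using limit_family_measurable[OF assms(1,3)] assms(2) by (simp add: order_invariant_def)
  ultimately show ?thesis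
    by (intro integrable_const_bound[of _ 1]) (auto simp: order_invariant_space[OF assms(2)])
qed

text \<open>
  This is the characterisation of \<open>N(E)\<close> as the conditional probability \<open>\<mu>(E | G)\<close>.  It is used
  with \<open>H\<close> the whole space, to recover \<open>\<mu>\<close> by averaging, and to describe \<open>\<mu>\<close> conditioned on \<open>H\<close>.
\<close>

lemma limit_family_disintegrates_on:
  assumes N: "limit_family N" and \<mu>: "order_invariant \<mu>"
    and E: "E \<in> sets F_alg" and H: "H \<in> sets G_alg"
  shows "measure \<mu> (H \<inter> E) = (\<integral>\<omega>. indicator H \<omega> * measure (N \<omega>) E \<partial>\<mu>)"
proof -
  interpret finite_measure_subalgebra \<mu> G_alg by (rule order_invariant_subalgebra[OF \<mu>])
  have [measurable_cong]: "sets \<mu> = sets F_alg" using \<mu> by (simp add: order_invariant_def)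
  have EH: "E \<in> sets \<mu>" "H \<in> sets \<mu>"
    using E H sets_G_alg_subset \<open>sets \<mu> = sets F_alg\<close> by auto
  have "measure \<mu> (H \<inter> E) = (\<integral>\<omega>. indicator H \<omega> * indicator E \<omega> \<partial>\<mu>)"
    using EH by (simp flip: indicator_inter_arith)
  also have "\<dots> = (\<integral>\<omega>. indicator H \<omega> * real_cond_exp \<mu> G_alg (indicator E) \<omega> \<partial>\<mu>)"
    using EH H by (intro real_cond_exp_intg(2)[symmetric])
      (auto simp flip: indicator_inter_arith simp: less_top[symmetric])
  also have "\<dots> = (\<integral>\<omega>. indicator H \<omega> * measure (N \<omega>) E \<partial>\<mu>)"
  proof (rule integral_cong_AE)
    show "(\<lambda>\<omega>. indicator H \<omega> * real_cond_exp \<mu> G_alg (indicator E) \<omega>) \<in> borel_measurable \<mu>"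
      using EH by simp
    show "(\<lambda>\<omega>. indicator H \<omega> * measure (N \<omega>) E) \<in> borel_measurable \<mu>"
      using EH limit_family_measurable[OF N E \<open>sets \<mu> = _\<close>] by simp
    have "AE \<omega> in \<mu>. measure (N \<omega>) E = real_cond_exp \<mu> G_alg (indicator E) \<omega>"
      using N \<mu> E by (simp add: limit_family_def)
    then show "AE \<omega> in \<mu>. indicator H \<omega> * real_cond_exp \<mu> G_alg (indicator E) \<omega> =
        indicator H \<omega> * measure (N \<omega>) E" by eventually_elim simp
  qed
  finally show ?thesis .
qed

corollary limit_family_disintegrates:
  assumes N: "limit_family N" and \<mu>: "order_invariant \<mu>" and E: "E \<in> sets F_alg"
  shows "measure \<mu> E = (\<integral>\<omega>. measure (N \<omega>) E \<partial>\<mu>)"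
proof -
  have "Omega \<in> sets G_alg" using sets.top[of G_alg] by simp
  then have "measure \<mu> (Omega \<inter> E) = (\<integral>\<omega>. indicator Omega \<omega> * measure (N \<omega>) E \<partial>\<mu>)"
    by (rule limit_family_disintegrates_on[OF N \<mu> E])
  also have "\<dots> = (\<integral>\<omega>. measure (N \<omega>) E \<partial>\<mu>)"
    by (rule Bochner_Integration.integral_cong) (simp_all add: order_invariant_space[OF \<mu>])
  finally show ?thesis using sets.sets_into_space[OF E] by (simp add: Int_absorb1)
qed

lemma limit_family_tail_event:
  assumes N: "limit_family N" and \<mu>: "order_invariant \<mu>" and H: "H \<in> sets G_alg"
  shows "AE \<omega> in \<mu>. measure (N \<omega>) H = indicator H \<omega>"
proof -
  interpret finite_measure_subalgebra \<mu> G_alg by (rule order_invariant_subalgebra[OF \<mu>])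
  have HF: "H \<in> sets F_alg" using H sets_G_alg_subset by blast
  then have "H \<in> sets \<mu>" using \<mu> by (simp add: order_invariant_def)
  then have "AE \<omega> in \<mu>. real_cond_exp \<mu> G_alg (indicator H) \<omega> = indicator H \<omega>"
    using H by (intro real_cond_exp_F_meas) (auto simp: less_top[symmetric])
  moreover have "AE \<omega> in \<mu>. measure (N \<omega>) H = real_cond_exp \<mu> G_alg (indicator H) \<omega>"
    using N \<mu> HF by (simp add: limit_family_def)
  ultimately show ?thesis by eventually_elim simp
qed

section \<open>Extremality as concentration on a fibre of the limit family\<close>

definition fibre :: "(point \<Rightarrow> point measure) \<Rightarrow> point measure \<Rightarrow> point set" where
  "fibre N \<nu> = {\<omega> \<in> Omega. N \<omega> = \<nu>}"

lemma fibre_in_tail: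
  assumes N: "limit_family N" and \<nu>: "order_invariant \<nu>"
  shows "fibre N \<nu> \<in> sets G_alg"
proof -
  obtain C where C: "countable C" "C \<subseteq> sets F_alg"
    "\<And>\<mu> \<nu>. order_invariant \<mu> \<Longrightarrow> order_invariant \<nu> \<Longrightarrow>
      (\<And>E. E \<in> C \<Longrightarrow> measure \<mu> E = measure \<nu> E) \<Longrightarrow> \<mu> = \<nu>"
    using countable_separating_events by blast
  have "fibre N \<nu> = {\<omega> \<in> space G_alg. \<forall>E\<in>C. measure (N \<omega>) E = measure \<nu> E}"
    using C(3)[OF _ \<nu>] N by (auto simp: fibre_def limit_family_def)
  also have "\<dots> \<in> sets G_alg"
  proof (rule sets_Collect_Ball_countable[OF C(1)])
    fix E assume "E \<in> C"
    then have [measurable]: "(\<lambda>\<omega>. measure (N \<omega>) E) \<in> borel_measurable G_alg"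
      using N C(2) by (auto simp: limit_family_def)
    show "{\<omega> \<in> space G_alg. measure (N \<omega>) E = measure \<nu> E} \<in> sets G_alg" by measurable
  qed
  finally show ?thesis .
qed

text \<open>
  Both components of a mixture inherit the event \<open>N = \<nu>\<close> of full measure, and a measure under
  which \<open>N = \<nu>\<close> almost surely is the average of the constant \<open>\<nu>\<close>.
\<close>

lemma extremal_if_concentrated:
  assumes N: "limit_family N" and \<nu>: "order_invariant \<nu>" and conc: "measure \<nu> (fibre N \<nu>) = 1"
  shows "extremal \<nu>"
  unfolding extremal_def
proof (intro notI, elim exE conjE)
  fix r :: real and \<mu>1 \<mu>2
  assume r: "0 < r" "r < 1" and \<mu>: "order_invariant \<mu>1" "order_invariant \<mu>2" and "\<mu>1 \<noteq> \<mu>2"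
    and mix: "\<forall>E\<in>sets F_alg. measure \<nu> E = r * measure \<mu>1 E + (1 - r) * measure \<mu>2 E"
  interpret \<mu>1: prob_space \<mu>1 using \<mu> by (simp add: order_invariant_def)
  interpret \<mu>2: prob_space \<mu>2 using \<mu> by (simp add: order_invariant_def)
  let ?D = "fibre N \<nu>"
  have D: "?D \<in> sets F_alg" using fibre_in_tail[OF N \<nu>] sets_G_alg_subset by blast
  have "1 = r * measure \<mu>1 ?D + (1 - r) * measure \<mu>2 ?D" using mix D conc by auto
  moreover have "r * measure \<mu>1 ?D \<le> r" "(1 - r) * measure \<mu>2 ?D \<le> 1 - r"
    using r by (simp_all add: mult_left_le)
  ultimately have "r * measure \<mu>1 ?D = r" "(1 - r) * measure \<mu>2 ?D = 1 - r" by linarith+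
  then have D1: "measure \<mu>1 ?D = 1" "measure \<mu>2 ?D = 1" using r by simp_all
  have eq: "measure \<kappa> E = measure \<nu> E"
    if \<kappa>: "order_invariant \<kappa>" and 1: "measure \<kappa> ?D = 1" and E: "E \<in> sets F_alg" for \<kappa> E
  proof -
    interpret \<kappa>: prob_space \<kappa> using \<kappa> by (simp add: order_invariant_def)
    have "AE \<omega> in \<kappa>. \<omega> \<in> ?D"
      using 1 D \<kappa> by (subst \<kappa>.AE_in_set_eq_1) (auto simp: order_invariant_def)
    then have "(\<integral>\<omega>. measure (N \<omega>) E \<partial>\<kappa>) = (\<integral>\<omega>. measure \<nu> E \<partial>\<kappa>)"
      using limit_family_integrable[OF N \<kappa> E]
      by (intro integral_cong_AE) (auto simp: fibre_def)
    then show ?thesis using limit_family_disintegrates[OF N \<kappa> E] \<kappa>.prob_space by simp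
  qed
  obtain C where C: "countable C" "C \<subseteq> sets F_alg"
    "\<And>\<mu> \<nu>. order_invariant \<mu> \<Longrightarrow> order_invariant \<nu> \<Longrightarrow>
      (\<And>E. E \<in> C \<Longrightarrow> measure \<mu> E = measure \<nu> E) \<Longrightarrow> \<mu> = \<nu>"
    using countable_separating_events by blast
  have "\<mu>1 = \<mu>2" using C(2) eq \<mu> D1 by (intro C(3)) (auto simp: subset_iff)
  then show False using \<open>\<mu>1 \<noteq> \<mu>2\<close> by contradiction
qed

lemma permuted_basic_event_in_sets:
  assumes "\<And>i. i < k \<Longrightarrow> borel_in_unit (B i)" "suborder_upto k R" "l \<in> linear_extensions k R"
  shows "basic_event k (\<lambda>i. B (l i)) (permute_order l R) \<in> sets F_alg"
proof (rule basic_event_in_sets)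
  have in_k: "l i < k \<longleftrightarrow> i < k" for i
    using assms(3) permutes_in_image[of l "{..<k}" i] by (auto simp: linear_extensions_def)
  then show "borel_in_unit (B (l i))" if "i < k" for i using assms(1) that by simp
  have "i < k \<and> j < k \<and> i < j" if "R (l i) (l j)" for i j
  proof -
    have "i < k" "j < k" using that assms(2) in_k by (auto simp: suborder_upto_def)
    then show ?thesis using that assms(3) by (simp add: linear_extensions_def)
  qed
  then show "suborder_upto k (permute_order l R)"
    using assms(2) by (auto simp: suborder_upto_def suborder_def permute_order_def irreflp_def transp_def)
qed

text \<open>
  By disintegration the conditioned measure is the average over \<open>H\<close> of the order-invariant measures
  \<open>N \<omega>\<close>, and order-invariance, being a family of linear equations, passes to averages.
\<close>

lemma order_invariant_conditioned:
  assumes N: "limit_family N" and \<mu>: "order_invariant \<mu>"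
    and H: "H \<in> sets G_alg" "measure \<mu> H \<noteq> 0"
  shows "order_invariant (uniform_measure \<mu> H)"
proof -
  interpret prob_space \<mu> using \<mu> by (simp add: order_invariant_def)
  have HM: "H \<in> sets \<mu>" and sets: "sets \<mu> = sets F_alg"
    using H sets_G_alg_subset \<mu> by (auto simp: order_invariant_def)
  have pos: "emeasure \<mu> H \<noteq> 0" using H(2) by (simp add: emeasure_eq_measure)
  have val: "measure (uniform_measure \<mu> H) E = (\<integral>\<omega>. indicator H \<omega> * measure (N \<omega>) E \<partial>\<mu>) / measure \<mu> H"
    if "E \<in> sets F_alg" for E
    using that pos HM sets limit_family_disintegrates_on[OF N \<mu> that H(1)]
    by (simp add: measure_uniform_measure)
  show ?thesis
    unfolding order_invariant_def
  proof (intro conjI allI impI)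
    show "prob_space (uniform_measure \<mu> H)" using pos by (intro prob_space_uniform_measure) auto
    show "sets (uniform_measure \<mu> H) = sets F_alg" using sets by simp
  next
    fix k B R l
    assume *: "\<forall>i<k. borel_in_unit (B i)" "suborder_upto k R" "l \<in> linear_extensions k R"
    let ?E = "basic_event k B R" and ?E' = "basic_event k (\<lambda>i. B (l i)) (permute_order l R)"
    have same: "measure (N \<omega>) ?E = measure (N \<omega>) ?E'" if "\<omega> \<in> Omega" for \<omega>
    proof -
      have "order_invariant (N \<omega>)" using N that by (simp add: limit_family_def)
      then show ?thesis using * unfolding order_invariant_def by blast
    qed
    have "?E \<in> sets F_alg" "?E' \<in> sets F_alg"
      using * by (auto intro: basic_event_in_sets permuted_basic_event_in_sets)
    moreover have "(\<integral>\<omega>. indicator H \<omega> * measure (N \<omega>) ?E \<partial>\<mu>) = (\<integral>\<omega>. indicator H \<omega> * measure (N \<omega>) ?E' \<partial>\<mu>)"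
      using same by (intro Bochner_Integration.integral_cong) (simp_all add: order_invariant_space[OF \<mu>])
    ultimately show "measure (uniform_measure \<mu> H) ?E = measure (uniform_measure \<mu> H) ?E'"
      by (simp only: val)
  qed
qed

text \<open>
  Otherwise \<open>\<nu>\<close> is a proper mixture of its conditionings on \<open>H\<close> and on the complement of \<open>H\<close>,
  which differ on \<open>H\<close>.
\<close>

lemma extremal_tail_trivial:
  assumes N: "limit_family N" and \<nu>: "order_invariant \<nu>" "extremal \<nu>" and H: "H \<in> sets G_alg"
  shows "measure \<nu> H = 0 \<or> measure \<nu> H = 1"
proof (rule ccontr)
  assume nontrivial: "\<not> (measure \<nu> H = 0 \<or> measure \<nu> H = 1)"
  interpret prob_space \<nu> using \<nu> by (simp add: order_invariant_def)
  let ?p = "measure \<nu> H" and ?H' = "Omega - H"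
  let ?\<mu>1 = "uniform_measure \<nu> H" and ?\<mu>2 = "uniform_measure \<nu> ?H'"
  have sets: "sets \<nu> = sets F_alg" using \<nu> by (simp add: order_invariant_def)
  have HM: "H \<in> sets \<nu>" "?H' \<in> sets \<nu>"
    using H sets_G_alg_subset sets sets.compl_sets[of H F_alg] by auto
  have p: "0 < ?p" "?p < 1"
    using nontrivial prob_le_1[of H] by (auto simp: less_le)
  have p': "measure \<nu> ?H' = 1 - ?p"
    using prob_compl[OF HM(1)] by (simp add: order_invariant_space[OF \<nu>(1)])
  have "?H' \<in> sets G_alg" using H sets.compl_sets[of H G_alg] by simp
  then have oi: "order_invariant ?\<mu>1" "order_invariant ?\<mu>2"
    using order_invariant_conditioned[OF N \<nu>(1)] H p p' by auto
  have pos: "emeasure \<nu> H \<noteq> 0" "emeasure \<nu> ?H' \<noteq> 0"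
    using p p' by (auto simp: emeasure_eq_measure)
  have val: "measure ?\<mu>1 E = measure \<nu> (H \<inter> E) / ?p" "measure ?\<mu>2 E = measure \<nu> (?H' \<inter> E) / (1 - ?p)"
    if "E \<in> sets F_alg" for E
    using that sets pos HM p' by (simp_all add: measure_uniform_measure)
  have "measure ?\<mu>1 H = 1" "measure ?\<mu>2 H = 0"
    using val[of H] HM sets p by (simp_all add: Int_commute)
  then have "?\<mu>1 \<noteq> ?\<mu>2" by (metis zero_neq_one)
  moreover have "measure \<nu> E = ?p * measure ?\<mu>1 E + (1 - ?p) * measure ?\<mu>2 E" if "E \<in> sets F_alg" for E
  proof -
    have "E = (H \<inter> E) \<union> (?H' \<inter> E)" using sets.sets_into_space[OF that] by auto
    then have "measure \<nu> E = measure \<nu> (H \<inter> E) + measure \<nu> (?H' \<inter> E)"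
      using finite_measure_Union[of "H \<inter> E" "?H' \<inter> E"] HM that sets by auto
    then show ?thesis using val[OF that] p by simp
  qed
  ultimately have "\<not> extremal \<nu>" unfolding extremal_def using oi p by blast
  then show False using \<nu>(2) by contradiction
qed

text \<open>
  For fixed \<open>E\<close>, the tail-measurable function \<open>N(E)\<close> has mean \<open>\<nu>(E)\<close>.  The tail events that it lies
  below, respectively above, its mean have probability 0 or 1, and probability 1 is impossible.
\<close>

lemma concentrated_if_extremal:
  assumes N: "limit_family N" and \<nu>: "order_invariant \<nu>" "extremal \<nu>"
  shows "AE \<omega> in \<nu>. N \<omega> = \<nu>"
proof -
  interpret prob_space \<nu> using \<nu> by (simp add: order_invariant_def)
  have sets: "sets \<nu> = sets F_alg" and space: "space \<nu> = Omega"
    using \<nu> order_invariant_space by (auto simp: order_invariant_def)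
  have const: "AE \<omega> in \<nu>. measure (N \<omega>) E = measure \<nu> E" if E: "E \<in> sets F_alg" for E
  proof -
    let ?f = "\<lambda>\<omega>. measure (N \<omega>) E" and ?c = "measure \<nu> E"
    have f[measurable]: "?f \<in> borel_measurable G_alg" using N E by (simp add: limit_family_def)
    have int: "integrable \<nu> ?f" "(\<integral>\<omega>. ?f \<omega> \<partial>\<nu>) = (\<integral>\<omega>. ?c \<partial>\<nu>)"
      using limit_family_integrable[OF N \<nu>(1) E] limit_family_disintegrates[OF N \<nu>(1) E] prob_space
      by simp_all
    have AE_or: "(AE \<omega> in \<nu>. \<omega> \<in> H) \<or> (AE \<omega> in \<nu>. \<omega> \<notin> H)" if "H \<in> sets G_alg" for H
    proof -
      have "H \<in> events" using that sets_G_alg_subset sets by auto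
      then show ?thesis
        using extremal_tail_trivial[OF N \<nu> that] AE_in_set_eq_1[of H] prob_eq_0[of H] by auto
    qed
    have le: "{\<omega> \<in> space G_alg. ?f \<omega> < ?c} \<in> sets G_alg" and ge: "{\<omega> \<in> space G_alg. ?c < ?f \<omega>} \<in> sets G_alg"
      by measurable
    have "\<not> (AE \<omega> in \<nu>. \<omega> \<in> {\<omega> \<in> space G_alg. ?f \<omega> < ?c})"
    proof
      assume "AE \<omega> in \<nu>. \<omega> \<in> {\<omega> \<in> space G_alg. ?f \<omega> < ?c}"
      then have "(\<integral>\<omega>. ?f \<omega> \<partial>\<nu>) < (\<integral>\<omega>. ?c \<partial>\<nu>)"
        using int by (intro integral_less_AE_space) (auto simp: emeasure_space_1)
      then show False using int by simp
    qed
    then have 1: "AE \<omega> in \<nu>. \<not> ?f \<omega> < ?c" using AE_or[OF le] by (auto simp: space elim!: AE_mp)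
    have "\<not> (AE \<omega> in \<nu>. \<omega> \<in> {\<omega> \<in> space G_alg. ?c < ?f \<omega>})"
    proof
      assume "AE \<omega> in \<nu>. \<omega> \<in> {\<omega> \<in> space G_alg. ?c < ?f \<omega>}"
      then have "(\<integral>\<omega>. ?c \<partial>\<nu>) < (\<integral>\<omega>. ?f \<omega> \<partial>\<nu>)"
        using int by (intro integral_less_AE_space) (auto simp: emeasure_space_1)
      then show False using int by simp
    qed
    then have 2: "AE \<omega> in \<nu>. \<not> ?c < ?f \<omega>" using AE_or[OF ge] by (auto simp: space elim!: AE_mp)
    from 1 2 show ?thesis by eventually_elim simp
  qed
  obtain C where C: "countable C" "C \<subseteq> sets F_alg"
    "\<And>\<mu> \<nu>. order_invariant \<mu> \<Longrightarrow> order_invariant \<nu> \<Longrightarrow>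
      (\<And>E. E \<in> C \<Longrightarrow> measure \<mu> E = measure \<nu> E) \<Longrightarrow> \<mu> = \<nu>"
    using countable_separating_events by blast
  have "AE \<omega> in \<nu>. \<forall>E\<in>C. measure (N \<omega>) E = measure \<nu> E"
    using C(1,2) const by (subst AE_ball_countable) auto
  moreover have "AE \<omega> in \<nu>. \<omega> \<in> Omega" using AE_space[of \<nu>] space by simp
  ultimately show ?thesis
  proof eventually_elim
    case (elim \<omega>)
    then show ?case using N C(3)[OF _ \<nu>(1)] by (auto simp: limit_family_def)
  qed
qed

section \<open>Almost every member of the limit family is extremal\<close>

definition concentrated_points :: "(point \<Rightarrow> point measure) \<Rightarrow> point set" where
  "concentrated_points N = {\<omega> \<in> Omega. measure (N \<omega>) (fibre N (N \<omega>)) = 1}"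

lemma concentrated_points_extremal:
  assumes "limit_family N" "\<omega> \<in> concentrated_points N"
  shows "N \<omega> \<in> extremal_measures"
  using assms extremal_if_concentrated[of N "N \<omega>"]
  by (auto simp: concentrated_points_def extremal_measures_def limit_family_def)

text \<open>
  Concentration of \<open>N \<omega>\<close> on its own fibre means that, under \<open>N \<omega>\<close>, almost every \<open>\<omega>'\<close> lies on the
  same side as \<open>\<omega>\<close> of each event \<open>{N(E) \<le> q}\<close>.  Each of these countably many conditions is one
  equation between \<open>N \<omega> H\<close> and \<open>indicator H \<omega>\<close>, which gives both the measurability of the set of
  concentrated points and, by \<open>limit_family_tail_event\<close>, its full measure.
\<close>

lemma concentrated_points_countable:
  assumes N: "limit_family N"
  obtains \<H> where "countable \<H>" "\<H> \<subseteq> sets G_alg"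
    "concentrated_points N = {\<omega> \<in> Omega. \<forall>H\<in>\<H>. measure (N \<omega>) H = indicator H \<omega>}"
proof -
  obtain C where C: "countable C" "C \<subseteq> sets F_alg"
    "\<And>\<mu> \<nu>. order_invariant \<mu> \<Longrightarrow> order_invariant \<nu> \<Longrightarrow>
      (\<And>E. E \<in> C \<Longrightarrow> measure \<mu> E = measure \<nu> E) \<Longrightarrow> \<mu> = \<nu>"
    using countable_separating_events by blast
  define A where "A E q = {\<omega> \<in> space G_alg. measure (N \<omega>) E \<le> q}" for E and q :: real
  have A: "A E q \<in> sets G_alg" if "E \<in> C" for E q
  proof -
    have [measurable]: "(\<lambda>\<omega>. measure (N \<omega>) E) \<in> borel_measurable G_alg"
      using N C(2) that by (auto simp: limit_family_def)
    show ?thesis unfolding A_def by measurable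
  qed
  define \<H> where "\<H> = (\<lambda>(E, q). A E q) ` (C \<times> \<rat>)"
  have \<H>: "countable \<H>" "\<H> \<subseteq> sets G_alg"
    using C(1) A by (auto simp: \<H>_def countable_rat)
  have "measure (N \<omega>) (fibre N (N \<omega>)) = 1 \<longleftrightarrow> (\<forall>H\<in>\<H>. measure (N \<omega>) H = indicator H \<omega>)"
    if \<omega>: "\<omega> \<in> Omega" for \<omega>
  proof -
    let ?\<nu> = "N \<omega>"
    have \<nu>: "order_invariant ?\<nu>" using N \<omega> by (simp add: limit_family_def)
    interpret prob_space ?\<nu> using \<nu> by (simp add: order_invariant_def)
    have sets: "sets ?\<nu> = sets F_alg" and space: "space ?\<nu> = Omega"
      using \<nu> order_invariant_space by (auto simp: order_invariant_def)
    have ev: "H \<in> events" if "H \<in> sets G_alg" for H using that sets_G_alg_subset sets by auto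
    have fib: "fibre N ?\<nu> \<in> events" by (intro ev fibre_in_tail N \<nu>)
    have \<H>_iff: "prob H = indicator H \<omega> \<longleftrightarrow> (AE \<omega>' in ?\<nu>. \<omega>' \<in> H \<longleftrightarrow> \<omega> \<in> H)" if "H \<in> sets G_alg" for H
      using AE_in_set_eq_1[OF ev[OF that]] prob_eq_0[OF ev[OF that]] by (cases "\<omega> \<in> H") auto
    have "prob (fibre N ?\<nu>) = 1 \<longleftrightarrow> (AE \<omega>' in ?\<nu>. \<omega>' \<in> fibre N ?\<nu>)"
      using AE_in_set_eq_1[OF fib] by simp
    also have "\<dots> \<longleftrightarrow> (AE \<omega>' in ?\<nu>. \<forall>H\<in>\<H>. \<omega>' \<in> H \<longleftrightarrow> \<omega> \<in> H)"
    proof (rule AE_cong)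
      fix \<omega>' assume "\<omega>' \<in> space ?\<nu>"
      then have \<omega>': "\<omega>' \<in> Omega" by (simp add: space)
      show "\<omega>' \<in> fibre N ?\<nu> \<longleftrightarrow> (\<forall>H\<in>\<H>. \<omega>' \<in> H \<longleftrightarrow> \<omega> \<in> H)"
      proof
        assume "\<omega>' \<in> fibre N ?\<nu>"
        then show "\<forall>H\<in>\<H>. \<omega>' \<in> H \<longleftrightarrow> \<omega> \<in> H" using \<omega> by (auto simp: fibre_def \<H>_def A_def)
      next
        assume *: "\<forall>H\<in>\<H>. \<omega>' \<in> H \<longleftrightarrow> \<omega> \<in> H"
        have "measure (N \<omega>') E = measure ?\<nu> E" if E: "E \<in> C" for E
        proof -
          have iff: "measure (N \<omega>') E \<le> q \<longleftrightarrow> measure ?\<nu> E \<le> q" if "q \<in> \<rat>" for q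
            using * that E \<omega> \<omega>' by (auto simp: \<H>_def A_def)
          then show ?thesis
            by (meson Rats_dense_in_real linorder_neqE_linordered_idom not_le less_imp_le)
        qed
        then have "N \<omega>' = ?\<nu>" using N \<omega>' \<nu> by (intro C(3)) (auto simp: limit_family_def)
        then show "\<omega>' \<in> fibre N ?\<nu>" using \<omega>' by (simp add: fibre_def)
      qed
    qed
    also have "\<dots> \<longleftrightarrow> (\<forall>H\<in>\<H>. prob H = indicator H \<omega>)"
      using \<H> \<H>_iff by (subst AE_ball_countable) auto
    finally show ?thesis .
  qed
  then have "concentrated_points N = {\<omega> \<in> Omega. \<forall>H\<in>\<H>. measure (N \<omega>) H = indicator H \<omega>}"
    unfolding concentrated_points_def by blast
  with \<H> show ?thesis by (rule that)
qed

lemma concentrated_points_in_sets: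
  assumes N: "limit_family N"
  shows "concentrated_points N \<in> sets F_alg"
proof -
  obtain \<H> where \<H>: "countable \<H>" "\<H> \<subseteq> sets G_alg"
    "concentrated_points N = {\<omega> \<in> Omega. \<forall>H\<in>\<H>. measure (N \<omega>) H = indicator H \<omega>}"
    using concentrated_points_countable[OF N] by blast
  have "{\<omega> \<in> space F_alg. \<forall>H\<in>\<H>. measure (N \<omega>) H = indicator H \<omega>} \<in> sets F_alg"
  proof (rule sets_Collect_Ball_countable[OF \<H>(1)])
    fix H assume "H \<in> \<H>"
    then have H[measurable]: "H \<in> sets F_alg" using \<H>(2) sets_G_alg_subset by blast
    have [measurable]: "(\<lambda>\<omega>. measure (N \<omega>) H) \<in> borel_measurable F_alg"
      by (rule limit_family_measurable[OF N H refl])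
    show "{\<omega> \<in> space F_alg. measure (N \<omega>) H = indicator H \<omega>} \<in> sets F_alg" by measurable
  qed
  then show ?thesis using \<H>(3) by simp
qed

lemma AE_concentrated_points:
  assumes N: "limit_family N" and \<mu>: "order_invariant \<mu>"
  shows "AE \<omega> in \<mu>. \<omega> \<in> concentrated_points N"
proof -
  obtain \<H> where \<H>: "countable \<H>" "\<H> \<subseteq> sets G_alg"
    "concentrated_points N = {\<omega> \<in> Omega. \<forall>H\<in>\<H>. measure (N \<omega>) H = indicator H \<omega>}"
    using concentrated_points_countable[OF N] by blast
  have "AE \<omega> in \<mu>. \<forall>H\<in>\<H>. measure (N \<omega>) H = indicator H \<omega>"
    using \<H>(1,2) limit_family_tail_event[OF N \<mu>] by (subst AE_ball_countable) auto
  moreover have "AE \<omega> in \<mu>. \<omega> \<in> Omega" using AE_space[of \<mu>] order_invariant_space[OF \<mu>] by simp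
  ultimately show ?thesis by eventually_elim (simp add: \<H>(3))
qed

section \<open>The decomposition into extremal measures and its uniqueness\<close>

text \<open>
  The value off the concentrated points is \<open>N\<close> at some concentrated point, which exists because
  \<open>\<mu>\<close> gives these points full measure.  The resulting \<open>V\<close> is a version of \<open>N\<close> under every
  order-invariant measure at once; uniqueness of the decomposition rests on this.
\<close>

lemma extremal_version:
  assumes N: "limit_family N" and \<mu>: "order_invariant \<mu>"
  obtains V where "\<And>\<omega>. V \<omega> \<in> extremal_measures"
    "\<And>\<omega>. \<omega> \<in> concentrated_points N \<Longrightarrow> V \<omega> = N \<omega>"
    "V \<in> F_alg \<rightarrow>\<^sub>M extremal_algebra"
proof -
  let ?M = "concentrated_points N"
  interpret prob_space \<mu> using \<mu> by (simp add: order_invariant_def)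
  obtain \<omega>0 where \<omega>0: "\<omega>0 \<in> ?M"
    using eventually_happens'[OF _ AE_concentrated_points[OF N \<mu>]] ae_filter_eq_bot_iff[of \<mu>]
      emeasure_space_1 by auto
  define V where "V \<omega> = (if \<omega> \<in> ?M then N \<omega> else N \<omega>0)" for \<omega>
  have ext: "V \<omega> \<in> extremal_measures" for \<omega>
    using concentrated_points_extremal[OF N] \<omega>0 by (simp add: V_def)
  have "V \<in> F_alg \<rightarrow>\<^sub>M prob_algebra F_alg"
  proof (rule measurable_prob_algebraI)
    show "prob_space (V \<omega>)" for \<omega> using ext[of \<omega>] by (simp add: extremal_measures_def order_invariant_def)
    show "V \<in> F_alg \<rightarrow>\<^sub>M subprob_algebra F_alg"
    proof (rule measurable_subprob_algebra)
      fix \<omega>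
      show "subprob_space (V \<omega>)" "sets (V \<omega>) = sets F_alg"
        using ext[of \<omega>] by (auto simp: extremal_measures_def order_invariant_def prob_space_imp_subprob_space)
    next
      fix E assume E: "E \<in> sets F_alg"
      have [measurable]: "(\<lambda>\<omega>. measure (N \<omega>) E) \<in> borel_measurable F_alg" "?M \<in> sets F_alg"
        using limit_family_measurable[OF N E refl] concentrated_points_in_sets[OF N] by simp_all
      have "emeasure (V \<omega>) E = ennreal (if \<omega> \<in> ?M then measure (N \<omega>) E else measure (N \<omega>0) E)" for \<omega>
        using ext[of \<omega>] finite_measure.emeasure_eq_measure[of "V \<omega>" E]
        by (auto simp: extremal_measures_def order_invariant_def prob_space_def V_def)
      then show "(\<lambda>\<omega>. emeasure (V \<omega>) E) \<in> borel_measurable F_alg" by simp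
    qed
  qed
  then have "V \<in> F_alg \<rightarrow>\<^sub>M extremal_algebra"
    unfolding extremal_algebra_def using ext by (intro measurable_restrict_space2) auto
  with ext show ?thesis by (intro that[of V]) (simp_all add: V_def)
qed

theorem corollary7p6:
  fixes nuhat :: "point \<Rightarrow> point measure" and \<mu> :: "point measure"
  assumes nuhat: "limit_family nuhat"
    and \<mu>: "order_invariant \<mu>"
  shows "\<exists>nutilde :: point \<Rightarrow> point measure.
    (\<forall>\<omega>\<in>Omega. nutilde \<omega> \<in> extremal_measures) \<and>
    (AE \<omega> in \<mu>. nutilde \<omega> = nuhat \<omega>) \<and>
    nutilde \<in> completion \<mu> \<rightarrow>\<^sub>M extremal_algebra \<and>
    (\<forall>E\<in>sets F_alg. emeasure \<mu> E = (\<integral>\<^sup>+\<omega>. emeasure (nutilde \<omega>) E \<partial>completion \<mu>)) \<and>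
    (\<forall>w :: point measure measure.
      prob_space w \<longrightarrow> sets w = sets extremal_algebra \<longrightarrow>
      (\<forall>E\<in>sets F_alg. emeasure \<mu> E = (\<integral>\<^sup>+\<nu>. emeasure \<nu> E \<partial>w)) \<longrightarrow>
      (\<forall>S\<in>sets extremal_algebra.
        emeasure w S = emeasure (completion \<mu>) {\<omega> \<in> Omega. nutilde \<omega> \<in> S}))"
proof -
  have sets: "sets \<mu> = sets F_alg" and space: "space \<mu> = Omega"
    using \<mu> order_invariant_space by (auto simp: order_invariant_def)
  \<comment> \<open>\<open>V\<close> is measurable for \<^const>\<open>F_alg\<close> itself, so \<open>{V \<in> S}\<close> may be measured by every extremal \<open>\<nu>\<close>.\<close>
  obtain V where V: "\<And>\<omega>. V \<omega> \<in> extremal_measures"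
    "\<And>\<omega>. \<omega> \<in> concentrated_points nuhat \<Longrightarrow> V \<omega> = nuhat \<omega>"
    "V \<in> F_alg \<rightarrow>\<^sub>M extremal_algebra"
    using extremal_version[OF nuhat \<mu>] by blast
  have version: "AE \<omega> in \<nu>. V \<omega> = nuhat \<omega>" if "order_invariant \<nu>" for \<nu>
    using AE_concentrated_points[OF nuhat that] by eventually_elim (rule V(2))
  have meas: "V \<in> \<mu> \<rightarrow>\<^sub>M extremal_algebra"
    using V(3) measurable_cong_sets[OF sets refl] by blast
  have mix: "emeasure \<mu> E = (\<integral>\<^sup>+\<omega>. emeasure (V \<omega>) E \<partial>completion \<mu>)" if E: "E \<in> sets F_alg" for E
  proof -
    interpret prob_space \<mu> using \<mu> by (simp add: order_invariant_def)
    have "emeasure \<mu> E = ennreal (\<integral>\<omega>. measure (nuhat \<omega>) E \<partial>\<mu>)"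
      by (simp add: emeasure_eq_measure limit_family_disintegrates[OF nuhat \<mu> E])
    also have "\<dots> = (\<integral>\<^sup>+\<omega>. ennreal (measure (nuhat \<omega>) E) \<partial>\<mu>)"
      using limit_family_integrable[OF nuhat \<mu> E] by (simp add: nn_integral_eq_integral)
    also have "\<dots> = (\<integral>\<^sup>+\<omega>. emeasure (V \<omega>) E \<partial>\<mu>)"
    proof (rule nn_integral_cong_AE)
      show "AE \<omega> in \<mu>. ennreal (measure (nuhat \<omega>) E) = emeasure (V \<omega>) E"
        using version[OF \<mu>]
      proof eventually_elim
        case (elim \<omega>)
        then show ?case
          using V(1)[of \<omega>] finite_measure.emeasure_eq_measure[of "V \<omega>" E]
          by (simp add: extremal_measures_def order_invariant_def prob_space_def)
      qed
    qed
    finally show ?thesis by (simp add: nn_integral_completion)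
  qed
  have uniq: "emeasure w S = emeasure (completion \<mu>) {\<omega> \<in> Omega. V \<omega> \<in> S}"
    if w: "sets w = sets extremal_algebra" "\<forall>E\<in>sets F_alg. emeasure \<mu> E = (\<integral>\<^sup>+\<nu>. emeasure \<nu> E \<partial>w)"
      and S: "S \<in> sets extremal_algebra" for w S
  proof -
    \<comment> \<open>Extremal measures are told apart by where \<open>V\<close> sends their points: \<open>\<nu>(T)\<close> is the indicator of \<open>\<nu> \<in> S\<close>.\<close>
    let ?T = "{\<omega> \<in> Omega. V \<omega> \<in> S}"
    have "?T = V -` S \<inter> space F_alg" by auto
    then have T: "?T \<in> sets F_alg" using measurable_sets[OF V(3) S] by simp
    have "emeasure \<nu> ?T = indicator S \<nu>" if "\<nu> \<in> space w" for \<nu>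
    proof -
      have "\<nu> \<in> extremal_measures"
        using that sets_eq_imp_space_eq[OF w(1)] by (simp add: space_extremal_algebra)
      then have \<nu>: "order_invariant \<nu>" "extremal \<nu>" by (auto simp: extremal_measures_def)
      interpret prob_space \<nu> using \<nu> by (simp add: order_invariant_def)
      have "AE \<omega> in \<nu>. V \<omega> = \<nu>"
        using version[OF \<nu>(1)] concentrated_if_extremal[OF nuhat \<nu>] by eventually_elim simp
      then have "AE \<omega> in \<nu>. \<omega> \<in> ?T \<longleftrightarrow> \<nu> \<in> S"
        using AE_space[of \<nu>] by eventually_elim (simp add: order_invariant_space[OF \<nu>(1)])
      then have "emeasure \<nu> ?T = emeasure \<nu> (if \<nu> \<in> S then space \<nu> else {})"
        using T \<nu>(1) by (intro emeasure_eq_AE) (auto simp: order_invariant_def elim!: AE_mp)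
      then show ?thesis by (simp add: emeasure_space_1)
    qed
    then have "(\<integral>\<^sup>+\<nu>. emeasure \<nu> ?T \<partial>w) = (\<integral>\<^sup>+\<nu>. indicator S \<nu> \<partial>w)"
      by (rule nn_integral_cong)
    then have "emeasure w S = emeasure \<mu> ?T" using w S T by simp
    then show ?thesis using T sets by simp
  qed
  show ?thesis
    using V(1) version[OF \<mu>] measurable_completion[OF meas] mix uniq by (intro exI[of _ V]) simp
qed

end
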